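(* Let $X$ be a Hausdorff space. A norm-closed ideal $J\subseteq C_b(X)$ is a projection band in $C_b(X)$ if and only if $J=J_F(X)$ for some clopen set $F\subseteq X$.
   Context: $C_b(X)$ is the Banach lattice of bounded continuous real-valued functions on $X$ with the supremum norm and pointwise order. Ideal means order ideal: a linear subspace $Y$ of a vector lattice $E$ such that $0\le |x|\le |y|$ with $x\in E$, $y\in Y$ implies $x\in Y$ (for norm-closed subspaces of $C_b(X)$ order ideals and algebra ideals are the same). A band $B$ in a vector lattice $E$ is an order ideal such that whenever $(x_\alpha)$ is a net in $B$ with $0\le x_\alpha\nearrow x$ in $E$ (i.e. the net is increasing with supremum $x$ in $E$), then $x\in B$. The disjoint complement of $B$ is $B^d=\{x\in E: |x|\wedge |b|=0\text{ for all } b\in B\}$; a band $B$ is a projection band if $E=B\oplus B^d$. For $F\subseteq X$, $J_F(X)=\{f\in C_b(X): f|_F\equiv 0\}$. *)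

theory Defs
  imports "HOL-Analysis.Analysis" "HOL-Library.Lattice_Algebras" "HOL-Library.Lub_Glb"
begin

section \<open>Vector lattices, bands and projection bands\<close>

class vector_lattice = ordered_real_vector + lattice_ab_group_add_abs

text \<open>The condition \<open>0 \<le> \<bar>x\<bar>\<close> in the usual formulation of solidity holds for every \<open>x\<close>.\<close>

definition order_ideal :: "'a::vector_lattice set \<Rightarrow> bool" where
  "order_ideal Y \<longleftrightarrow> subspace Y \<and> (\<forall>x. \<forall>y\<in>Y. \<bar>x\<bar> \<le> \<bar>y\<bar> \<longrightarrow> x \<in> Y)"

definition increasing_net ::
    "'i set \<Rightarrow> ('i \<Rightarrow> 'i \<Rightarrow> bool) \<Rightarrow> ('i \<Rightarrow> 'a::order) \<Rightarrow> bool" where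
  "increasing_net I le x \<longleftrightarrow>
     I \<noteq> {} \<and>
     (\<forall>i\<in>I. le i i) \<and>
     (\<forall>i\<in>I. \<forall>j\<in>I. \<forall>k\<in>I. le i j \<longrightarrow> le j k \<longrightarrow> le i k) \<and>
     (\<forall>i\<in>I. \<forall>j\<in>I. \<exists>k\<in>I. le i k \<and> le j k) \<and>
     (\<forall>i\<in>I. \<forall>j\<in>I. le i j \<longrightarrow> x i \<le> x j)"

text \<open>
  A definition cannot quantify over the type of the index set of a net, so the index sets are
  taken inside the vector lattice itself. This loses no generality, because the range of an
  increasing net is upward directed and can serve as its own index set; see \<open>band_netD\<close> below.
\<close>

definition band :: "'a::vector_lattice set \<Rightarrow> bool" where
  "band B \<longleftrightarrow> order_ideal B \<and>
     (\<forall>(I::'a set) le x s.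
        increasing_net I le x \<and> (\<forall>i\<in>I. x i \<in> B \<and> 0 \<le> x i) \<and> isLub UNIV (x ` I) s
        \<longrightarrow> s \<in> B)"

lemma band_netD:
  fixes I :: "'i set" and x :: "'i \<Rightarrow> 'a::vector_lattice"
  assumes "band B" and net: "increasing_net I le x"
    and B: "\<And>i. i \<in> I \<Longrightarrow> x i \<in> B \<and> 0 \<le> x i" and lub: "isLub UNIV (x ` I) s"
  shows "s \<in> B"
proof -
  have dir: "\<exists>k\<in>I. x i \<le> x k \<and> x j \<le> x k" if "i \<in> I" "j \<in> I" for i j
    using net that unfolding increasing_net_def by meson
  have "I \<noteq> {}" using net unfolding increasing_net_def by blast
  then have "increasing_net (x ` I) (\<le>) (\<lambda>y. y)"
    using dir unfolding increasing_net_def by auto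
  moreover have "\<forall>y\<in>x ` I. y \<in> B \<and> 0 \<le> y" using B by blast
  moreover have "isLub UNIV ((\<lambda>y. y) ` (x ` I)) s" using lub by simp
  ultimately show ?thesis
    using \<open>band B\<close> unfolding band_def by blast
qed

definition disjoint_complement :: "'a::vector_lattice set \<Rightarrow> 'a set" where
  "disjoint_complement B = {x. \<forall>b\<in>B. inf \<bar>x\<bar> \<bar>b\<bar> = 0}"

definition projection_band :: "'a::vector_lattice set \<Rightarrow> bool" where
  "projection_band B \<longleftrightarrow> band B \<and>
     {b + c | b c. b \<in> B \<and> c \<in> disjoint_complement B} = UNIV \<and>
     B \<inter> disjoint_complement B = {0}"

section \<open>The vector lattice of bounded continuous functions\<close>

text \<open>
  \<open>C\<^sub>b(X)\<close> is the type \<open>'a \<Rightarrow>\<^sub>C real\<close>, whose norm is the supremum norm. The library provides no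
  order on it.
\<close>

unbundle bcontfun.lifting

lemma eucl_norm_abs: "norm \<bar>x\<bar> = norm (x::'a::ordered_euclidean_space)"
  by (auto simp: norm_eq_sqrt_inner euclidean_inner[of "\<bar>x\<bar>" "\<bar>x\<bar>"] euclidean_inner[of x x] abs_inner)

lemma eucl_sup_eq: "sup x y = (1/2) *\<^sub>R (x + y + \<bar>x - y\<bar>)"
  for x y :: "'a::ordered_euclidean_space"
  by (rule euclidean_eqI)
    (auto simp: inner_Basis_sup_left abs_inner inner_add_left inner_diff_left sup_real_def max_def abs_if field_simps)

lemma eucl_inf_eq: "inf x y = (1/2) *\<^sub>R (x + y - \<bar>x - y\<bar>)"
  for x y :: "'a::ordered_euclidean_space"
  by (rule euclidean_eqI)
    (auto simp: inner_Basis_inf_left abs_inner inner_add_left inner_diff_left inf_real_def min_def abs_if field_simps)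

lemma eucl_abs_eq: "\<bar>x\<bar> = sup x (- x)"
  for x :: "'a::ordered_euclidean_space"
  by (rule euclidean_eqI) (auto simp: inner_Basis_sup_left abs_inner sup_real_def max_def abs_if)

lemma abs_cont: "f \<in> bcontfun \<Longrightarrow> (\<lambda>x. \<bar>f x\<bar>) \<in> bcontfun"
  for f :: "'a::topological_space \<Rightarrow> 'b::ordered_euclidean_space"
proof -
  assume f: "f \<in> bcontfun"
  then have "continuous_on UNIV (\<lambda>x. \<Sum>i\<in>Basis. \<bar>f x \<bullet> i\<bar> *\<^sub>R i)"
    by (auto simp: bcontfun_def intro!: continuous_intros)
  with f show ?thesis
    by (simp add: bcontfun_def bounded_iff eucl_norm_abs flip: eucl_abs)
qed

lemma sup_cont: "f \<in> bcontfun \<Longrightarrow> g \<in> bcontfun \<Longrightarrow> (\<lambda>x. sup (f x) (g x)) \<in> bcontfun"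
  for f g :: "'a::topological_space \<Rightarrow> 'b::ordered_euclidean_space"
  unfolding eucl_sup_eq by (intro scaleR_cont plus_cont abs_cont minus_cont)

lemma inf_cont: "f \<in> bcontfun \<Longrightarrow> g \<in> bcontfun \<Longrightarrow> (\<lambda>x. inf (f x) (g x)) \<in> bcontfun"
  for f g :: "'a::topological_space \<Rightarrow> 'b::ordered_euclidean_space"
  unfolding eucl_inf_eq by (intro scaleR_cont plus_cont abs_cont minus_cont)

instantiation bcontfun :: (topological_space, ordered_euclidean_space) vector_lattice
begin

lift_definition less_eq_bcontfun :: "('a \<Rightarrow>\<^sub>C 'b) \<Rightarrow> ('a \<Rightarrow>\<^sub>C 'b) \<Rightarrow> bool"
  is "\<lambda>f g. \<forall>x. f x \<le> g x" .

definition less_bcontfun :: "('a \<Rightarrow>\<^sub>C 'b) \<Rightarrow> ('a \<Rightarrow>\<^sub>C 'b) \<Rightarrow> bool" where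
  "less_bcontfun f g \<longleftrightarrow> f \<le> g \<and> \<not> g \<le> f"

lift_definition inf_bcontfun :: "('a \<Rightarrow>\<^sub>C 'b) \<Rightarrow> ('a \<Rightarrow>\<^sub>C 'b) \<Rightarrow> 'a \<Rightarrow>\<^sub>C 'b"
  is "\<lambda>f g x. inf (f x) (g x)"
  by (rule inf_cont)

lift_definition sup_bcontfun :: "('a \<Rightarrow>\<^sub>C 'b) \<Rightarrow> ('a \<Rightarrow>\<^sub>C 'b) \<Rightarrow> 'a \<Rightarrow>\<^sub>C 'b"
  is "\<lambda>f g x. sup (f x) (g x)"
  by (rule sup_cont)

lift_definition abs_bcontfun :: "('a \<Rightarrow>\<^sub>C 'b) \<Rightarrow> 'a \<Rightarrow>\<^sub>C 'b"
  is "\<lambda>f x. \<bar>f x\<bar>"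
  by (rule abs_cont)

instance
proof
  fix f g h :: "'a \<Rightarrow>\<^sub>C 'b" and r s :: real
  show "f < g \<longleftrightarrow> f \<le> g \<and> \<not> g \<le> f" by (rule less_bcontfun_def)
  show "f \<le> f" by transfer simp
  show "f \<le> h" if "f \<le> g" "g \<le> h" using that by transfer (blast intro: order_trans)
  show "f = g" if "f \<le> g" "g \<le> f"
    using that by transfer (auto intro!: ext antisym)
  show "h + f \<le> h + g" if "f \<le> g" using that by transfer (simp add: add_left_mono)
  show "r *\<^sub>R f \<le> r *\<^sub>R g" if "f \<le> g" "0 \<le> r"
    using that by transfer (simp add: scaleR_left_mono)
  show "r *\<^sub>R f \<le> s *\<^sub>R f" if "r \<le> s" "0 \<le> f"
    using that by transfer (simp add: scaleR_right_mono)
  show "inf f g \<le> f" "inf f g \<le> g" by (transfer, simp)+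
  show "h \<le> inf f g" if "h \<le> f" "h \<le> g" using that by transfer simp
  show "f \<le> sup f g" "g \<le> sup f g" by (transfer, simp)+
  show "sup f g \<le> h" if "f \<le> h" "g \<le> h" using that by transfer simp
  show "\<bar>f\<bar> = sup f (- f)" by transfer (simp add: eucl_abs_eq)
qed

end

lemmas [simp] = inf_bcontfun.rep_eq sup_bcontfun.rep_eq abs_bcontfun.rep_eq

lifting_update bcontfun.lifting
lifting_forget bcontfun.lifting

definition vanishing_ideal :: "'a::topological_space set \<Rightarrow> ('a \<Rightarrow>\<^sub>C real) set" where
  "vanishing_ideal F = {f. \<forall>x\<in>F. apply_bcontfun f x = 0}"

end

theory Submission
  imports Defs
begin

text \<open>
  If \<open>J\<close> is a projection band, split the constant function \<open>1 = b + c\<close> with \<open>b\<close> in \<open>J\<close> and \<open>c\<close>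
  disjoint from \<open>J\<close>. Disjointness forces \<open>b\<close> to take only the values \<open>0\<close> and \<open>1\<close>, so its zero set
  is clopen, and \<open>J\<close> consists of the functions vanishing there. Conversely, multiplication by the
  characteristic functions of a clopen set and of its complement splits every function.
\<close>

lemma bcontfun_le_iff:
  fixes f g :: "'a::topological_space \<Rightarrow>\<^sub>C 'b::ordered_euclidean_space"
  shows "f \<le> g \<longleftrightarrow> (\<forall>x. apply_bcontfun f x \<le> apply_bcontfun g x)"
  by (rule less_eq_bcontfun.rep_eq)

lemma bcontfun_eq_iff:
  fixes f g :: "'a::topological_space \<Rightarrow>\<^sub>C 'b::metric_space"
  shows "f = g \<longleftrightarrow> (\<forall>x. apply_bcontfun f x = apply_bcontfun g x)"
  by (auto intro: bcontfun_eqI)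

text \<open>Truncation to a clopen set stays in the space. It provides both the summands that split
  a function and the competing upper bound in the band property.\<close>

lemma clopen_restriction_bcontfun:
  fixes f :: "'a::topological_space \<Rightarrow>\<^sub>C 'b::real_normed_vector"
  assumes "open F" "closed F"
  obtains g where "\<And>x. apply_bcontfun g x = (if x \<in> F then apply_bcontfun f x else 0)"
proof -
  let ?h = "\<lambda>x. if x \<in> F then apply_bcontfun f x else 0"
  \<comment> \<open>The whole space is written as a union of two closed pieces, \<open>- F\<close>
    being closed because \<open>F\<close> is open, so that the branches can be pasted.\<close>
  have "continuous_on (F \<union> - F) ?h"
    using assms by (intro continuous_on_If) (auto intro!: continuous_intros)
  moreover have "bounded (range ?h)"
    unfolding bounded_iff using norm_bounded[of f] by (intro exI[of _ "norm f"]) auto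
  ultimately have "?h \<in> bcontfun"
    by (simp add: bcontfun_def Compl_partition)
  then show thesis
    by (intro that[of "Bcontfun ?h"]) (simp add: Bcontfun_inverse)
qed

text \<open>Lattice operations are pointwise, and the minimum of two absolute values in the reals is
  zero only if one of them is.\<close>

lemma mem_disjoint_complement_bcontfun:
  fixes B :: "('a::topological_space \<Rightarrow>\<^sub>C real) set"
  shows "c \<in> disjoint_complement B \<longleftrightarrow>
    (\<forall>b\<in>B. \<forall>x. apply_bcontfun b x = 0 \<or> apply_bcontfun c x = 0)"
proof -
  have "inf \<bar>s\<bar> \<bar>t\<bar> = 0 \<longleftrightarrow> t = 0 \<or> s = 0" for s t :: real
    by (auto simp: inf_real_def min_def)
  then show ?thesis
    by (simp add: disjoint_complement_def bcontfun_eq_iff)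
qed

lemma projection_band_imp_vanishing_ideal:
  fixes J :: "('a::topological_space \<Rightarrow>\<^sub>C real) set"
  assumes "projection_band J"
  obtains F where "open F" "closed F" "J = vanishing_ideal F"
proof -
  have ideal: "order_ideal J"
    using assms by (simp add: projection_band_def band_def)
  have "const_bcontfun 1 \<in> {b + c | b c. b \<in> J \<and> c \<in> disjoint_complement J}"
    using assms by (simp add: projection_band_def)
  then obtain b c where b: "b \<in> J" and c: "c \<in> disjoint_complement J"
    and one: "const_bcontfun 1 = b + c" by blast
  have sum: "apply_bcontfun b x + apply_bcontfun c x = 1" for x
    using arg_cong[OF one, of "\<lambda>f. apply_bcontfun f x"] by simp
  have c0: "apply_bcontfun f x = 0 \<or> apply_bcontfun c x = 0" if "f \<in> J" for f x
    using c that by (simp add: mem_disjoint_complement_bcontfun)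
  \<comment> \<open>At each point \<open>b\<close> or \<open>c\<close> vanishes, and the other one
    then carries the whole sum 1.\<close>
  have b01: "apply_bcontfun b x = 0 \<or> apply_bcontfun b x = 1" for x
    using sum[of x] c0[OF b, of x] by auto
  define F where "F = {x. apply_bcontfun b x = 0}"
  have "closed F"
    unfolding F_def by (intro closed_Collect_eq continuous_on_apply_bcontfun continuous_on_const)
  moreover have "open F"
  proof -
    \<comment> \<open>The gap between the values 0 and 1 turns the zero set into a strict sublevel
      set, which is open.\<close>
    have "F = {x. apply_bcontfun b x < 1}"
      unfolding F_def
    proof (rule Collect_cong)
      show "apply_bcontfun b x = 0 \<longleftrightarrow> apply_bcontfun b x < 1" for x
        using b01[of x] by auto
    qed
    then show ?thesis
      by (simp add: open_Collect_less)
  qed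
  moreover have "J = vanishing_ideal F"
  proof (intro equalityI subsetI)
    fix f assume "f \<in> J"
    have "apply_bcontfun f x = 0" if "apply_bcontfun b x = 0" for x
      using sum[of x] c0[OF \<open>f \<in> J\<close>, of x] that by auto
    then show "f \<in> vanishing_ideal F"
      by (simp add: vanishing_ideal_def F_def)
  next
    fix f assume f: "f \<in> vanishing_ideal F"
    \<comment> \<open>On \<open>F\<close> both sides are 0; off \<open>F\<close>, \<open>b\<close>
      is 1 and the bound is the supremum norm. Solidity of \<open>J\<close> then applies.\<close>
    have "\<bar>apply_bcontfun f x\<bar> \<le> \<bar>norm f * apply_bcontfun b x\<bar>" for x
      using b01[of x] f norm_bounded[of f x] by (auto simp: vanishing_ideal_def F_def)
    then have "\<bar>f\<bar> \<le> \<bar>norm f *\<^sub>R b\<bar>"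
      by (simp add: bcontfun_le_iff)
    moreover have "norm f *\<^sub>R b \<in> J"
      using ideal b by (simp add: order_ideal_def subspace_scale)
    ultimately show "f \<in> J"
      using ideal by (auto simp: order_ideal_def)
  qed
  ultimately show thesis by (intro that)
qed

lemma order_ideal_vanishing_ideal:
  "order_ideal (vanishing_ideal F :: ('a::topological_space \<Rightarrow>\<^sub>C real) set)"
  unfolding order_ideal_def
proof (intro conjI allI ballI impI)
  fix f g :: "'a \<Rightarrow>\<^sub>C real"
  assume g: "g \<in> vanishing_ideal F" and "\<bar>f\<bar> \<le> \<bar>g\<bar>"
  then have le: "\<bar>apply_bcontfun f x\<bar> \<le> \<bar>apply_bcontfun g x\<bar>" for x
    by (simp add: bcontfun_le_iff)
  have "apply_bcontfun f x = 0" if "x \<in> F" for x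
    using le[of x] g that by (simp add: vanishing_ideal_def)
  then show "f \<in> vanishing_ideal F"
    by (simp add: vanishing_ideal_def)
qed (simp add: subspace_def vanishing_ideal_def)

lemma band_vanishing_ideal:
  fixes F :: "'a::topological_space set"
  assumes "open F" "closed F"
  shows "band (vanishing_ideal F)"
  unfolding band_def
proof (intro conjI order_ideal_vanishing_ideal allI impI, elim conjE)
  fix I :: "('a \<Rightarrow>\<^sub>C real) set" and le x s
  assume net: "increasing_net I le x" and x: "\<forall>i\<in>I. x i \<in> vanishing_ideal F \<and> 0 \<le> x i"
    and lub: "isLub UNIV (x ` I) s"
  \<comment> \<open>Setting \<open>s\<close> to 0 on \<open>F\<close> keeps it an upper bound, since
    every \<open>x i\<close> vanishes there; the least upper bound \<open>s\<close> therefore lies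
    below \<open>t\<close>.\<close>
  obtain t where t: "\<And>p. apply_bcontfun t p = (if p \<in> - F then apply_bcontfun s p else 0)"
    using clopen_restriction_bcontfun[of "- F" s] assms by (auto simp: open_Compl closed_Compl)
  have ub: "x i \<le> s" if "i \<in> I" for i
    using isLubD2[OF lub] that by blast
  have "x i \<le> t" if "i \<in> I" for i
    using ub[OF that] x that by (auto simp: bcontfun_le_iff t vanishing_ideal_def)
  then have "s \<le> t"
    by (intro isLub_le_isUb[OF lub] isUbI setleI) auto
  \<comment> \<open>Any single member of the net gives 0 \<le> \<open>x i\<close> \<le>
    \<open>s\<close>, the lower estimate on \<open>F\<close>.\<close>
  moreover obtain i where "i \<in> I"
    using net by (auto simp: increasing_net_def)
  then have "0 \<le> s"
    using ub x order_trans by blast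
  ultimately have "apply_bcontfun s p = 0" if "p \<in> F" for p
    using that t[of p] by (metis ComplD antisym bcontfun_le_iff zero_bcontfun.rep_eq)
  then show "s \<in> vanishing_ideal F"
    by (simp add: vanishing_ideal_def)
qed

lemma projection_band_vanishing_ideal:
  fixes F :: "'a::topological_space set"
  assumes "open F" "closed F"
  shows "projection_band (vanishing_ideal F)"
proof -
  let ?J = "vanishing_ideal F"
  have "f \<in> {b + c | b c. b \<in> ?J \<and> c \<in> disjoint_complement ?J}" for f
  proof -
    \<comment> \<open>The part of \<open>f\<close> on \<open>F\<close> is the disjoint summand; the
      remainder \<open>f - c\<close> vanishes on \<open>F\<close>.\<close>
    obtain c where c: "\<And>p. apply_bcontfun c p = (if p \<in> F then apply_bcontfun f p else 0)"
      using clopen_restriction_bcontfun[OF assms] by blast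
    have "c \<in> disjoint_complement ?J"
      by (auto simp: mem_disjoint_complement_bcontfun vanishing_ideal_def c)
    moreover have "f - c \<in> ?J"
      by (simp add: vanishing_ideal_def c)
    moreover have "f = (f - c) + c" by simp
    ultimately show ?thesis by blast
  qed
  moreover have "?J \<inter> disjoint_complement ?J = {0}"
  proof (intro equalityI subsetI)
    \<comment> \<open>Such an \<open>f\<close> is disjoint from itself, hence zero at every
      point.\<close>
    fix f assume "f \<in> ?J \<inter> disjoint_complement ?J"
    then show "f \<in> {0}"
      by (auto simp: mem_disjoint_complement_bcontfun bcontfun_eq_iff)
  qed (simp add: mem_disjoint_complement_bcontfun vanishing_ideal_def)
  ultimately show ?thesis
    using band_vanishing_ideal[OF assms] unfolding projection_band_def by blast
qed

theorem theorem5p5: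
  fixes J :: "('a::t2_space \<Rightarrow>\<^sub>C real) set"
  assumes "closed J" and "order_ideal J"
  shows "projection_band J \<longleftrightarrow> (\<exists>F. open F \<and> closed F \<and> J = vanishing_ideal F)"
proof
  assume "projection_band J"
  then show "\<exists>F. open F \<and> closed F \<and> J = vanishing_ideal F"
    by (elim projection_band_imp_vanishing_ideal) blast
next
  assume "\<exists>F. open F \<and> closed F \<and> J = vanishing_ideal F"
  then show "projection_band J"
    by (elim exE conjE) (simp add: projection_band_vanishing_ideal)
qed

end
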